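(* Let $h\ge1$ be an integer, let $b\ge 0$ and let $(c_k)_{k\ge0}$ be a sequence of positive reals. Let $(\pi_k)_{k\ge0}$ be a sequence of policies generated from $\pi_0\in\mathrm{ri}(\Pi)$ by the inexact $h$-PMD update: for every $s\in\mathcal{S}$ and $k\ge 0$, $$\pi^{k+1}_s=\arg\max_{\pi_s\in\Delta(\mathcal{A})}\left\{\eta_k\langle \hat Q_h^{\pi_k}(s,\cdot),\pi_s\rangle - D_\phi(\pi_s,\pi^k_s)\right\},$$ where the estimates $\hat Q_h^{\pi_k}\in\mathbb{R}^{S\times A}$ satisfy $\|\hat Q_h^{\pi_k}-Q_h^{\pi_k}\|_\infty\le b$ for all $k$ (max norm over states and actions). For each $k$ let $\tilde{\mathcal{G}}_h=\arg\max_{\pi\in\Pi}M^\pi\hat Q_h^{\pi_k}$, and suppose the positive stepsizes satisfy $\eta_k\ge\frac1{c_k}\left\|\min_{\pi\in\tilde{\mathcal{G}}_h}D_\phi(\pi,\pi_k)\right\|_\infty$, the minimum being computed component-wise (state by state). Then for every $k\in\mathbb{N}$, $$\|V^\star-V^{\pi_k}\|_\infty\le\gamma^{hk}\left(\|V^\star-V^{\pi_0}\|_\infty+\frac{1}{1-\gamma}\sum_{t=1}^k\frac{c_{t-1}}{\gamma^{ht}}\right)+\frac{2b}{(1-\gamma)(1-\gamma^h)}.$$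
   Context: Setting: a discounted Markov decision process with finite state set $\mathcal{S}$ ($S=|\mathcal{S}|$), finite action set $\mathcal{A}$ ($A=|\mathcal{A}|$), transition kernel $P:\mathcal{S}\times\mathcal{A}\to\Delta(\mathcal{S})$ ($\Delta(\mathcal X)$ is the probability simplex over $\mathcal X$), reward $r:\mathcal{S}\times\mathcal{A}\to[0,1]$, discount $\gamma\in(0,1)$. $\Pi$ is the set of policies $\pi:\mathcal{S}\to\Delta(\mathcal{A})$, $\pi_s:=\pi(\cdot|s)$ (and $\pi^k_s:=\pi_k(\cdot|s)$); $\mathrm{ri}$ denotes relative interior. $V^\pi(s)=\mathbb{E}_\pi[\sum_{t\ge0}\gamma^t r(s_t,a_t)\mid s_0=s]$ and $V^\star$ is the optimal value function. Operators: for $V\in\mathbb{R}^S$, $(PV)(s,a)=\sum_{s'}P(s'|s,a)V(s')$; $(\mathcal{T}V)(s)=\max_a (r(s,a)+\gamma (PV)(s,a))$. For $Q\in\mathbb{R}^{SA}$, $(M^\pi Q)(s)=\sum_a\pi(a|s)Q(s,a)$. The $h$-step lookahead action-value function of $\pi$ is $Q_h^\pi:=r+\gamma P\mathcal{T}^{h-1}V^\pi\in\mathbb{R}^{SA}$. $\arg\max$ over $\Pi$ of an $\mathbb{R}^S$-valued expression is taken separately for each state component, so $\tilde{\mathcal{G}}_h$ is the set of policies greedy with respect to $\hat Q_h^{\pi_k}$ in every state (it depends on $k$). Mirror map: $\phi:\mathrm{dom}\,\phi\to\mathbb{R}$ is of Legendre type (strictly convex and essentially smooth in the relative interior of its domain)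 with $\Delta(\mathcal{A})\subset\mathrm{dom}\,\phi$. Its Bregman divergence is $D_\phi(p,q)=\phi(p)-\phi(q)-\langle\nabla\phi(q),p-q\rangle$, for $p\in\mathrm{dom}\,\phi$ and $q\in\mathrm{ri}(\mathrm{dom}\,\phi)$ (where $\nabla\phi$ exists); being generated by the algorithm includes that all divergences involved are defined. For policies, $D_\phi(\pi,\pi')\in\mathbb{R}^S$ is the vector with components $D_\phi(\pi_s,\pi'_s)$. *)

theory Defs
  imports "HOL-Analysis.Analysis" "HOL-Probability.Probability"
begin

section \<open>Policies\<close>

definition prob_simplex :: "(real ^ 'a) set" where
  "prob_simplex = {p. (\<forall>a. 0 \<le> p $ a) \<and> (\<Sum>a\<in>UNIV. p $ a) = 1}"

text \<open>A policy is the vector with \<^term>\<open>\<pi> $ s $ a\<close> the probability of action \<^term>\<open>a\<close> in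
  state \<^term>\<open>s\<close>, so that \<^const>\<open>rel_interior\<close> and the inner product apply to it.\<close>

definition policies :: "(real ^ 'a ^ 's) set" where
  "policies = {\<pi>. \<forall>s. \<pi> $ s \<in> prob_simplex}"

section \<open>The discounted Markov decision process\<close>

definition act_pmf :: "real ^ 'a ^ 's \<Rightarrow> 's \<Rightarrow> 'a pmf" where
  "act_pmf \<pi> s = embed_pmf (\<lambda>a. \<pi> $ s $ a)"

text \<open>The law of the time-\<^term>\<open>t\<close> state-action pair given the earlier ones: a state is drawn
  (it is \<^term>\<open>s0\<close> at time 0, and comes from the transition kernel afterwards), and then an
  action from the policy.\<close>

definition traj_kernel ::
  "('s \<Rightarrow> 'a \<Rightarrow> 's pmf) \<Rightarrow> real ^ 'a ^ 's \<Rightarrow> 's \<Rightarrow> nat \<Rightarrow> (nat \<Rightarrow> 's \<times> 'a) \<Rightarrow> ('s \<times> 'a) measure" where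
  "traj_kernel P \<pi> s0 t \<omega> = measure_pmf (
     do { s \<leftarrow> (case t of 0 \<Rightarrow> return_pmf s0 | Suc u \<Rightarrow> P (fst (\<omega> u)) (snd (\<omega> u)));
          a \<leftarrow> act_pmf \<pi> s;
          return_pmf (s, a) })"

text \<open>The law of the trajectory \<open>(s\<^sub>0, a\<^sub>0), (s\<^sub>1, a\<^sub>1), \<dots>\<close>, obtained from these kernels by the
  Ionescu-Tulcea theorem.\<close>

definition trajectory ::
  "('s \<Rightarrow> 'a \<Rightarrow> 's pmf) \<Rightarrow> real ^ 'a ^ 's \<Rightarrow> 's \<Rightarrow> (nat \<Rightarrow> 's \<times> 'a) measure" where
  "trajectory P \<pi> s0 =
     projective_family.lim UNIV
       (Ionescu_Tulcea.CI (traj_kernel P \<pi> s0) (\<lambda>_. count_space UNIV)) (\<lambda>_. count_space UNIV)"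

lemma Ionescu_Tulcea_traj_kernel:
  fixes P :: "'s::finite \<Rightarrow> 'a::finite \<Rightarrow> 's pmf"
  shows "Ionescu_Tulcea (traj_kernel P \<pi> s0) (\<lambda>_. count_space UNIV)"
proof (rule Ionescu_Tulcea.intro)
  fix t
  show "traj_kernel P \<pi> s0 t
      \<in> measurable (PiM {0..<t} (\<lambda>_. count_space UNIV)) (subprob_algebra (count_space UNIV))"
  proof (cases t)
    case 0
    then show ?thesis
      by (simp add: traj_kernel_def[abs_def] measurable_const measure_pmf_in_subprob_algebra)
  next
    case (Suc u)
    let ?K = "\<lambda>x. measure_pmf (P (fst x) (snd x) \<bind> (\<lambda>s. act_pmf \<pi> s \<bind> (\<lambda>a. return_pmf (s, a))))"
    have "?K \<in> measurable (count_space UNIV) (subprob_algebra (count_space UNIV))"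
      by (simp add: measure_pmf_in_subprob_algebra)
    moreover have "(\<lambda>\<omega>. \<omega> u) \<in> measurable (PiM {0..<t} (\<lambda>_. count_space UNIV)) (count_space UNIV)"
      by (rule measurable_component_singleton) (simp add: Suc)
    ultimately have "?K \<circ> (\<lambda>\<omega>. \<omega> u)
        \<in> measurable (PiM {0..<t} (\<lambda>_. count_space UNIV)) (subprob_algebra (count_space UNIV))"
      by (rule measurable_comp[rotated])
    then show ?thesis
      by (simp add: traj_kernel_def[abs_def] Suc comp_def)
  qed
next
  show "prob_space (traj_kernel P \<pi> s0 t \<omega>)" for t \<omega>
    unfolding traj_kernel_def by (rule measure_pmf.prob_space_axioms)
qed

definition value_fn ::
  "('s::finite \<Rightarrow> 'a \<Rightarrow> 's pmf) \<Rightarrow> ('s \<Rightarrow> 'a \<Rightarrow> real) \<Rightarrow> real \<Rightarrow> real ^ 'a ^ 's \<Rightarrow> real ^ 's" where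
  "value_fn P r \<gamma> \<pi> =
     (\<chi> s. \<integral>\<omega>. (\<Sum>t. \<gamma> ^ t * r (fst (\<omega> t)) (snd (\<omega> t))) \<partial>trajectory P \<pi> s)"

definition opt_value ::
  "('s::finite \<Rightarrow> 'a::finite \<Rightarrow> 's pmf) \<Rightarrow> ('s \<Rightarrow> 'a \<Rightarrow> real) \<Rightarrow> real \<Rightarrow> real ^ 's" where
  "opt_value P r \<gamma> = (\<chi> s. SUP \<pi>\<in>policies. value_fn P r \<gamma> \<pi> $ s)"

definition trans_op :: "('s::finite \<Rightarrow> 'a \<Rightarrow> 's pmf) \<Rightarrow> real ^ 's \<Rightarrow> real ^ 'a ^ 's" where
  "trans_op P V = (\<chi> s a. \<Sum>s'\<in>UNIV. pmf (P s a) s' * V $ s')"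

definition bellman_op ::
  "('s::finite \<Rightarrow> 'a::finite \<Rightarrow> 's pmf) \<Rightarrow> ('s \<Rightarrow> 'a \<Rightarrow> real) \<Rightarrow> real \<Rightarrow> real ^ 's \<Rightarrow> real ^ 's" where
  "bellman_op P r \<gamma> V = (\<chi> s. MAX a. r s a + \<gamma> * trans_op P V $ s $ a)"

definition policy_op :: "real ^ 'a ^ 's \<Rightarrow> real ^ 'a ^ 's \<Rightarrow> real ^ 's" where
  "policy_op \<pi> Q = (\<chi> s. \<Sum>a\<in>UNIV. \<pi> $ s $ a * Q $ s $ a)"

definition lookahead_Q ::
  "('s::finite \<Rightarrow> 'a::finite \<Rightarrow> 's pmf) \<Rightarrow> ('s \<Rightarrow> 'a \<Rightarrow> real) \<Rightarrow> real \<Rightarrow> nat \<Rightarrow> real ^ 'a ^ 's \<Rightarrow> real ^ 'a ^ 's"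
  where
  "lookahead_Q P r \<gamma> h \<pi> =
     (\<chi> s a. r s a + \<gamma> * trans_op P ((bellman_op P r \<gamma> ^^ (h - 1)) (value_fn P r \<gamma> \<pi>)) $ s $ a)"

definition greedy_policies :: "real ^ 'a ^ 's \<Rightarrow> (real ^ 'a ^ 's) set" where
  "greedy_policies Q =
     {\<pi>. \<forall>s. is_arg_max (\<lambda>\<pi>'. policy_op \<pi>' Q $ s) (\<lambda>\<pi>'. \<pi>' \<in> policies) \<pi>}"

section \<open>Mirror maps and Bregman divergences\<close>

text \<open>The domain of a mirror map may lie in a proper affine subspace (for instance, it may be the
  simplex itself), so the gradient is the one relative to the affine hull of the domain: it is
  normalised to lie in the direction space of that hull. If the domain has interior, it is the
  usual gradient there (lemma \<open>rel_gradient_interior\<close>).\<close>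

definition rel_gradient :: "('v::euclidean_space \<Rightarrow> real) \<Rightarrow> 'v set \<Rightarrow> 'v \<Rightarrow> 'v" where
  "rel_gradient \<phi> D q =
     (THE g. g \<in> span ((\<lambda>x. x - q) ` D) \<and> (\<phi> has_derivative (\<lambda>v. g \<bullet> v)) (at q within D))"

lemma rel_gradient_interior:
  fixes \<phi> :: "'v::euclidean_space \<Rightarrow> real"
  assumes "q \<in> interior D" and "GDERIV \<phi> q :> g"
  shows "rel_gradient \<phi> D q = g"
proof -
  have at: "at q within D = at q"
    using assms(1) by (rule at_within_interior)
  have "q + (0 - q) \<in> (\<lambda>x. x - q) ` interior D"
    using assms(1) by force
  moreover have "open ((\<lambda>x. x - q) ` interior D)"
    using open_translation_subtract[OF open_interior] by blast
  ultimately have "interior ((\<lambda>x. x - q) ` D) \<noteq> {}"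
    using interior_maximal[of "(\<lambda>x. x - q) ` interior D" "(\<lambda>x. x - q) ` D"]
      interior_subset[of D] by blast
  then have span: "span ((\<lambda>x. x - q) ` D) = UNIV"
    by (metis empty_interior_lowdim dim_eq_full linorder_neqE_nat not_less dim_subset_UNIV)
  have deriv: "(\<phi> has_derivative (\<lambda>v. g \<bullet> v)) (at q)"
    using assms(2) by (simp add: gderiv_def inner_commute)
  show ?thesis
    unfolding rel_gradient_def at span
  proof (rule the_equality)
    fix g' assume "g' \<in> UNIV \<and> (\<phi> has_derivative (\<lambda>v. g' \<bullet> v)) (at q)"
    with deriv have "(\<lambda>v. g' \<bullet> v) = (\<lambda>v. g \<bullet> v)"
      using has_derivative_unique by blast
    then show "g' = g"
      by (metis vector_eq_rdot inner_commute)
  qed (simp add: deriv)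
qed

text \<open>Convex function of Legendre type in the sense of Rockafellar, with the relative interior
  in place of the interior: the last two conditions are essential smoothness.\<close>

definition legendre_type :: "('v::euclidean_space \<Rightarrow> real) \<Rightarrow> 'v set \<Rightarrow> bool" where
  "legendre_type \<phi> D \<longleftrightarrow>
     D \<noteq> {} \<and> convex_on D \<phi> \<and>
     (\<forall>x\<in>rel_interior D. \<forall>y\<in>rel_interior D. \<forall>u::real. x \<noteq> y \<longrightarrow> 0 < u \<longrightarrow> u < 1 \<longrightarrow>
        \<phi> ((1 - u) *\<^sub>R x + u *\<^sub>R y) < (1 - u) * \<phi> x + u * \<phi> y) \<and>
     (\<forall>x\<in>rel_interior D. \<phi> differentiable (at x within D)) \<and>
     (\<forall>z\<in>rel_frontier D.
        filterlim (\<lambda>x. norm (rel_gradient \<phi> D x)) at_top (at z within rel_interior D))"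

definition bregman :: "('v::euclidean_space \<Rightarrow> real) \<Rightarrow> 'v set \<Rightarrow> 'v \<Rightarrow> 'v \<Rightarrow> real" where
  "bregman \<phi> D p q = \<phi> p - \<phi> q - rel_gradient \<phi> D q \<bullet> (p - q)"

definition policy_bregman ::
  "(real ^ 'a \<Rightarrow> real) \<Rightarrow> (real ^ 'a) set \<Rightarrow> real ^ 'a ^ 's \<Rightarrow> real ^ 'a ^ 's \<Rightarrow> real ^ 's" where
  "policy_bregman \<phi> D \<pi> \<pi>' = (\<chi> s. bregman \<phi> D (\<pi> $ s) (\<pi>' $ s))"

text \<open>Written as an infimum, since \<^const>\<open>Min\<close> only covers finite sets; it is the minimum
  whenever that exists. The divergences are nonnegative for a convex \<^term>\<open>\<phi>\<close>.\<close>

definition min_greedy_divergence ::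
  "(real ^ 'a \<Rightarrow> real) \<Rightarrow> (real ^ 'a) set \<Rightarrow> real ^ 'a ^ 's \<Rightarrow> real ^ 'a ^ 's \<Rightarrow> real ^ 's" where
  "min_greedy_divergence \<phi> D Q \<pi>' = (\<chi> s. INF \<pi>\<in>greedy_policies Q. policy_bregman \<phi> D \<pi> \<pi>' $ s)"

end

theory Submission
  imports Defs
begin

text \<open>Comparing the mirror step with a greedy policy, and using that Bregman divergences are
  nonnegative, shows that \<open>\<pi>\<^sub>k\<^sub>+\<^sub>1\<close> is \<open>c\<^sub>k\<close>-greedy for the estimate, hence \<open>(c\<^sub>k + 2 b)\<close>-greedy for
  the exact lookahead values. As \<open>\<T>\<^sup>h\<^sup>-\<^sup>1 V\<^sup>\<pi>\<close> increases under \<open>\<T>\<close>, this yields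
  \<open>\<T>\<^sup>h V\<^sub>k \<le> V\<^sub>k\<^sub>+\<^sub>1 + (c\<^sub>k + 2 b) / (1 - \<gamma>)\<close>. Since \<open>V\<^sup>\<star> \<le> \<T> V\<^sup>\<star>\<close> and \<open>\<T>\<^sup>h\<close> is a
  \<open>\<gamma>\<^sup>h\<close>-contraction, the error obeys
  \<open>e\<^sub>k\<^sub>+\<^sub>1 \<le> \<gamma>\<^sup>h e\<^sub>k + (c\<^sub>k + 2 b) / (1 - \<gamma>)\<close>, which is then iterated.\<close>

section \<open>Bregman divergences\<close>

text \<open>Convexity keeps the segment from \<open>q\<close> to \<open>x\<close> inside
  \<open>D\<close>, so the chain rule along it turns the derivative within \<open>D\<close> into a
  one-variable right derivative at 0. It serves both the gradient inequality and the uniqueness of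
  the relative gradient.\<close>

lemma directional_derivative_tendsto:
  fixes \<phi> :: "'v::euclidean_space \<Rightarrow> real"
  assumes "convex D" "q \<in> D" "x \<in> D"
    and "(\<phi> has_derivative (\<lambda>v. g \<bullet> v)) (at q within D)"
  shows "((\<lambda>t. (\<phi> (q + t *\<^sub>R (x - q)) - \<phi> q) / t) \<longlongrightarrow> g \<bullet> (x - q)) (at_right 0)"
proof -
  let ?l = "\<lambda>t::real. q + t *\<^sub>R (x - q)"
  have sub: "?l ` {0..1} \<subseteq> D"
  proof safe
    fix t :: real assume "t \<in> {0..1}"
    then have "(1 - t) *\<^sub>R q + t *\<^sub>R x \<in> D"
      using assms(1-3) by (auto simp: convex_alt)
    then show "?l t \<in> D" by (simp add: algebra_simps)
  qed
  have "(?l has_derivative (\<lambda>t. t *\<^sub>R (x - q))) (at 0 within {0..1})"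
    by (auto intro!: derivative_eq_intros)
  moreover have "(\<phi> has_derivative (\<lambda>v. g \<bullet> v)) (at (?l 0) within ?l ` {0..1})"
    using has_derivative_subset[OF assms(4) sub] by simp
  ultimately have "((\<phi> \<circ> ?l) has_derivative (\<lambda>v. g \<bullet> v) \<circ> (\<lambda>t. t *\<^sub>R (x - q)))
      (at 0 within {0..1})"
    by (rule diff_chain_within)
  then have "((\<lambda>t. \<phi> (?l t)) has_field_derivative g \<bullet> (x - q)) (at 0 within {0..1})"
    by (simp add: has_field_derivative_def comp_def mult_commute_abs)
  then show ?thesis
    by (simp add: has_field_derivative_iff at_within_Icc_at_right)
qed

text \<open>Convexity bounds each difference quotient along the segment, for
  \<open>0 < t < 1\<close>, by \<open>\<phi> x - \<phi> q\<close>, and the bound survives the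
  limit.\<close>

lemma convex_on_gradient_le:
  fixes \<phi> :: "'v::euclidean_space \<Rightarrow> real"
  assumes cvx: "convex_on D \<phi>" and "q \<in> D" "x \<in> D"
    and "(\<phi> has_derivative (\<lambda>v. g \<bullet> v)) (at q within D)"
  shows "g \<bullet> (x - q) \<le> \<phi> x - \<phi> q"
proof (rule tendsto_upperbound[OF directional_derivative_tendsto])
  show "\<forall>\<^sub>F t in at_right 0. (\<phi> (q + t *\<^sub>R (x - q)) - \<phi> q) / t \<le> \<phi> x - \<phi> q"
    unfolding eventually_at_right_field
  proof (intro exI[of _ 1] conjI allI impI)
    fix t :: real assume t: "0 < t" "t < 1"
    then have "\<phi> ((1 - t) *\<^sub>R q + t *\<^sub>R x) \<le> (1 - t) * \<phi> q + t * \<phi> x"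
      using cvx assms(2,3) by (simp add: convex_on_def)
    then have "\<phi> (q + t *\<^sub>R (x - q)) \<le> (1 - t) * \<phi> q + t * \<phi> x"
      by (simp add: algebra_simps)
    then show "(\<phi> (q + t *\<^sub>R (x - q)) - \<phi> q) / t \<le> \<phi> x - \<phi> q"
      using t by (simp add: field_simps)
  qed simp
qed (use assms convex_on_imp_convex in auto)

text \<open>Shows that the definite description in \<open>rel_gradient\<close> denotes. Existence:
  project a vector representing the derivative onto the direction space. Uniqueness: two candidates
  have equal directional derivatives towards every point of \<open>D\<close>, so their difference is
  orthogonal to a space that contains it.\<close>

lemma rel_gradient_has_derivative:
  fixes \<phi> :: "'v::euclidean_space \<Rightarrow> real"
  assumes cvx: "convex D" and q: "q \<in> D" and diff: "\<phi> differentiable (at q within D)"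
  shows "(\<phi> has_derivative (\<lambda>v. rel_gradient \<phi> D q \<bullet> v)) (at q within D)"
proof -
  let ?S = "(\<lambda>x. x - q) ` D"
  let ?P = "\<lambda>g. g \<in> span ?S \<and> (\<phi> has_derivative (\<lambda>v. g \<bullet> v)) (at q within D)"
  obtain L where L: "(\<phi> has_derivative L) (at q within D)"
    using diff by (auto simp: differentiable_def)
  \<comment> \<open>\<open>w\<close> is the Riesz representer of \<open>L\<close>.\<close>
  define w where "w = adjoint L (1::real)"
  have Lw: "L v = w \<bullet> v" for v
    using adjoint_works[OF has_derivative_linear[OF L], of v 1]
    by (simp add: w_def inner_commute)
  obtain y z where y: "y \<in> span ?S" and z: "\<And>u. u \<in> span ?S \<Longrightarrow> orthogonal z u"
    and wyz: "w = y + z"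
    using orthogonal_subspace_decomp_exists[of ?S w] by blast
  have Ly: "L (x - q) = y \<bullet> (x - q)" if "x \<in> D" for x
    using z[OF span_base, of "x - q"] that
    by (simp add: Lw wyz inner_add_left orthogonal_def)
  \<comment> \<open>Only increments \<open>x - q\<close> with \<open>x\<close> in \<open>D\<close>
    enter the limit; on these \<open>y\<close> acts as \<open>L\<close>, although the two may differ
    elsewhere.\<close>
  have "(\<phi> has_derivative (\<lambda>v. y \<bullet> v)) (at q within D)"
    using L unfolding has_derivative_within
    by (auto simp: bounded_linear_inner_right eventually_at_filter Ly
        elim!: Lim_transform_eventually)
  with y have ex: "?P y" by blast
  have "?P (THE g. ?P g)"
  proof (rule theI[of ?P, OF ex])
    fix g assume g: "?P g"
    have "g \<bullet> (x - q) = y \<bullet> (x - q)" if "x \<in> D" for x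
      using directional_derivative_tendsto[OF cvx q that]
        g ex tendsto_unique[OF trivial_limit_at_right_real] by blast
    then have "orthogonal (g - y) u" if "u \<in> ?S" for u
      using that by (auto simp: orthogonal_def inner_diff_left)
    then have "orthogonal (g - y) (g - y)"
      using orthogonal_to_span[of "g - y" ?S "g - y"] span_diff g y by blast
    then show "g = y" by (simp add: orthogonal_def)
  qed
  then show ?thesis by (simp add: rel_gradient_def)
qed

lemma bregman_nonneg:
  fixes \<phi> :: "'v::euclidean_space \<Rightarrow> real"
  assumes "legendre_type \<phi> D" "p \<in> D" "q \<in> rel_interior D"
  shows "0 \<le> bregman \<phi> D p q"
proof -
  have cvx: "convex_on D \<phi>" and diff: "\<phi> differentiable (at q within D)"
    using assms by (auto simp: legendre_type_def)
  have q: "q \<in> D" using assms(3) rel_interior_subset by blast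
  show ?thesis
    using convex_on_gradient_le[OF cvx q assms(2)
        rel_gradient_has_derivative[OF convex_on_imp_convex[OF cvx] q diff]]
    by (simp add: bregman_def)
qed

section \<open>The Bellman equation\<close>

lemma pmf_act_pmf:
  fixes \<pi> :: "real ^ 'a::finite ^ 's::finite"
  assumes "\<pi> \<in> policies"
  shows "pmf (act_pmf \<pi> s) a = \<pi> $ s $ a"
proof -
  have *: "\<And>a. 0 \<le> \<pi> $ s $ a" "(\<Sum>a\<in>UNIV. \<pi> $ s $ a) = 1"
    using assms by (auto simp: policies_def prob_simplex_def)
  then have "(\<integral>\<^sup>+ a. ennreal (\<pi> $ s $ a) \<partial>count_space UNIV) = 1"
    by (simp add: nn_integral_count_space_finite sum_ennreal)
  with * show ?thesis
    unfolding act_pmf_def by (intro pmf_embed_pmf)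
qed

section \<open>Marginal laws of the trajectory\<close>

definition state_action_pmf :: "real ^ 'a::finite ^ 's::finite \<Rightarrow> 's \<Rightarrow> ('s \<times> 'a) pmf" where
  "state_action_pmf \<pi> s = act_pmf \<pi> s \<bind> (\<lambda>a. return_pmf (s, a))"

text \<open>The law of the time-\<open>t\<close> pair, obtained by running the kernels forward;
  integrals over the trajectory measure are reduced to these finite objects.\<close>

primrec marginal_pmf ::
  "('s::finite \<Rightarrow> 'a::finite \<Rightarrow> 's pmf) \<Rightarrow> real ^ 'a ^ 's \<Rightarrow> 's \<Rightarrow> nat \<Rightarrow> ('s \<times> 'a) pmf" where
  "marginal_pmf P \<pi> s 0 = state_action_pmf \<pi> s"
| "marginal_pmf P \<pi> s (Suc t) =
     marginal_pmf P \<pi> s t \<bind> (\<lambda>x. P (fst x) (snd x) \<bind> state_action_pmf \<pi>)"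

lemma traj_kernel_0: "traj_kernel P \<pi> s 0 \<omega> = measure_pmf (state_action_pmf \<pi> s)"
  by (simp add: traj_kernel_def state_action_pmf_def bind_return_pmf)

lemma traj_kernel_Suc:
  "traj_kernel P \<pi> s (Suc t) \<omega> =
     measure_pmf (P (fst (\<omega> t)) (snd (\<omega> t)) \<bind> state_action_pmf \<pi>)"
  by (simp add: traj_kernel_def state_action_pmf_def[abs_def])

text \<open>The definition appends a transition at the end, whereas the Bellman equation conditions
  on the first one; associativity of bind passes between the two.\<close>

lemma marginal_pmf_Suc_shift:
  "marginal_pmf P \<pi> s (Suc t) =
     state_action_pmf \<pi> s \<bind> (\<lambda>x. P (fst x) (snd x) \<bind> (\<lambda>s'. marginal_pmf P \<pi> s' t))"
proof (induction t)
  case (Suc t)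
  show ?case
    by (subst marginal_pmf.simps(2), subst Suc) (simp add: bind_assoc_pmf)
qed simp

text \<open>The limit measure projects onto the coordinates \<open>{0..<Suc t}\<close> as the
  composition of the first \<open>Suc t\<close> kernels; integrating out the last kernel again and
  again leaves the marginal.\<close>

lemma trajectory_nn_integral:
  fixes P :: "'s::finite \<Rightarrow> 'a::finite \<Rightarrow> 's pmf"
  shows "(\<integral>\<^sup>+\<omega>. f (\<omega> t) \<partial>trajectory P \<pi> s) = (\<integral>\<^sup>+x. f x \<partial>marginal_pmf P \<pi> s t)"
proof -
  interpret IT: Ionescu_Tulcea "traj_kernel P \<pi> s" "\<lambda>_. count_space UNIV"
    by (rule Ionescu_Tulcea_traj_kernel)
  let ?M = "\<lambda>J :: nat set. PiM J (\<lambda>_. count_space (UNIV :: ('s \<times> 'a) set))"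
  have meas: "(\<lambda>\<omega>. f (\<omega> t)) \<in> borel_measurable (?M J)" if "t \<in> J" for f :: "'s \<times> 'a \<Rightarrow> ennreal" and t J
    using that by measurable
  have C_Suc: "(\<integral>\<^sup>+\<omega>. f (\<omega> t) \<partial>IT.C 0 (Suc t) (\<lambda>_. undefined)) =
      (\<integral>\<^sup>+\<omega>. \<integral>\<^sup>+x. f x \<partial>traj_kernel P \<pi> s t \<omega> \<partial>IT.C 0 t (\<lambda>_. undefined))"
    for f :: "'s \<times> 'a \<Rightarrow> ennreal" and t
  proof -
    have [measurable]: "(\<lambda>\<omega>. f (\<omega> t)) \<in> borel_measurable (?M {0..<Suc t})"
      by (rule meas) simp
    \<comment> \<open>The history before time 0 is empty, and \<open>\<lambda>_. undefined\<close>
      is the one point of the empty product.\<close>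
    have sp: "(\<lambda>_. undefined) \<in> space (?M {0..<0})" by (simp add: space_PiM)
    have "(\<integral>\<^sup>+\<omega>. f (\<omega> t) \<partial>IT.C 0 (Suc t) (\<lambda>_. undefined)) =
       (\<integral>\<^sup>+\<omega>. \<integral>\<^sup>+\<omega>'. f (\<omega>' t) \<partial>IT.eP t \<omega> \<partial>IT.C 0 t (\<lambda>_. undefined))"
      using IT.measurable_eP[of t] IT.sets_C[OF sp, of t]
      by (simp add: nn_integral_bind[where B="?M {0..<Suc t}"] cong: measurable_cong_sets)
    also have "\<dots> = (\<integral>\<^sup>+\<omega>. \<integral>\<^sup>+x. f x \<partial>traj_kernel P \<pi> s t \<omega> \<partial>IT.C 0 t (\<lambda>_. undefined))"
      using IT.space_C[OF sp, of t] by (intro nn_integral_cong) (simp add: IT.nn_integral_eP)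
    finally show ?thesis .
  qed
  have C: "(\<integral>\<^sup>+\<omega>. f (\<omega> t) \<partial>IT.C 0 (Suc t) (\<lambda>_. undefined)) = (\<integral>\<^sup>+x. f x \<partial>marginal_pmf P \<pi> s t)"
    for f :: "'s \<times> 'a \<Rightarrow> ennreal"
  \<comment> \<open>The induction hypothesis is applied to the function obtained by integrating
    \<open>f\<close> against the next kernel, hence the generalisation.\<close>
  proof (induction t arbitrary: f)
    case 0
    show ?case
      unfolding C_Suc
      by (simp add: traj_kernel_0 nn_integral_return space_PiM sets_PiM_empty)
  next
    case (Suc t)
    show ?case
      unfolding C_Suc traj_kernel_Suc marginal_pmf.simps nn_integral_bind_pmf
      by (rule Suc)
  qed
  let ?J = "{0..<Suc t}"
  \<comment> \<open>\<open>IT.CI ?J\<close> is defined through the least horizon covering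
    \<open>?J\<close>, which is \<open>Suc t\<close>.\<close>
  have up: "IT.up_to ?J = Suc t"
  proof (rule antisym)
    show "IT.up_to ?J \<le> Suc t" by (subst IT.up_to_iff) auto
    show "Suc t \<le> IT.up_to ?J" using IT.up_to_less[of ?J t] by simp
  qed
  have "(\<integral>\<^sup>+\<omega>. f (\<omega> t) \<partial>trajectory P \<pi> s) =
      (\<integral>\<^sup>+\<omega>. f (restrict \<omega> ?J t) \<partial>IT.PF.lim)"
    by (simp add: trajectory_def)
  also have "\<dots> = (\<integral>\<^sup>+\<omega>. f (\<omega> t) \<partial>distr IT.PF.lim (?M ?J) (\<lambda>\<omega>. restrict \<omega> ?J))"
    by (subst nn_integral_distr)
      (auto intro!: meas measurable_restrict_subset simp: measurable_cong_sets[OF IT.PF.sets_lim refl])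
  also have "\<dots> = (\<integral>\<^sup>+\<omega>. f (\<omega> t) \<partial>IT.CI ?J)"
    by (simp add: IT.distr_lim)
  also have "\<dots> = (\<integral>\<^sup>+\<omega>. f (restrict \<omega> ?J t) \<partial>IT.C 0 (Suc t) (\<lambda>_. undefined))"
    unfolding IT.CI_def up
    by (subst nn_integral_distr)
      (auto intro!: meas measurable_restrict_subset
        simp: measurable_cong_sets[OF IT.sets_C refl] space_PiM simp del: IT.C.simps)
  also have "\<dots> = (\<integral>\<^sup>+x. f x \<partial>marginal_pmf P \<pi> s t)"
    using C by (simp del: IT.C.simps)
  finally show ?thesis .
qed

lemma sets_trajectory:
  fixes P :: "'s::finite \<Rightarrow> 'a::finite \<Rightarrow> 's pmf"
  shows "sets (trajectory P \<pi> s) = sets (PiM UNIV (\<lambda>_. count_space UNIV))"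
proof -
  interpret IT: Ionescu_Tulcea "traj_kernel P \<pi> s" "\<lambda>_. count_space UNIV"
    by (rule Ionescu_Tulcea_traj_kernel)
  show ?thesis by (simp add: trajectory_def)
qed

lemma prob_space_trajectory:
  fixes P :: "'s::finite \<Rightarrow> 'a::finite \<Rightarrow> 's pmf"
  shows "prob_space (trajectory P \<pi> s)"
  using trajectory_nn_integral[where f = "\<lambda>_. 1" and t = 0]
  by (intro prob_spaceI) simp

lemma measurable_trajectory_component:
  fixes P :: "'s::finite \<Rightarrow> 'a::finite \<Rightarrow> 's pmf"
  shows "(\<lambda>\<omega>. \<omega> t) \<in> measurable (trajectory P \<pi> s) (count_space UNIV)"
  by (simp add: measurable_cong_sets[OF sets_trajectory refl] measurable_component_singleton)

text \<open>Testing on indicators upgrades the identity of nonnegative integrals to an equality of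
  laws, so that real-valued rewards can be integrated.\<close>

lemma distr_trajectory_component:
  fixes P :: "'s::finite \<Rightarrow> 'a::finite \<Rightarrow> 's pmf"
  shows "distr (trajectory P \<pi> s) (count_space UNIV) (\<lambda>\<omega>. \<omega> t) = measure_pmf (marginal_pmf P \<pi> s t)"
proof (rule measure_eqI)
  fix X
  show "emeasure (distr (trajectory P \<pi> s) (count_space UNIV) (\<lambda>\<omega>. \<omega> t)) X =
      emeasure (measure_pmf (marginal_pmf P \<pi> s t)) X"
    using trajectory_nn_integral[of P \<pi> s "indicator X" t]
      nn_integral_distr[OF measurable_trajectory_component, of "indicator X" P \<pi> s t]
    by simp
qed simp

section \<open>Expected rewards and the value series\<close>

definition expected_reward ::
  "('s::finite \<Rightarrow> 'a::finite \<Rightarrow> 's pmf) \<Rightarrow> ('s \<Rightarrow> 'a \<Rightarrow> real) \<Rightarrow> real ^ 'a ^ 's \<Rightarrow> nat \<Rightarrow> 's \<Rightarrow> real" where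
  "expected_reward P r \<pi> t s = measure_pmf.expectation (marginal_pmf P \<pi> s t) (\<lambda>x. r (fst x) (snd x))"

lemma trajectory_reward:
  fixes P :: "'s::finite \<Rightarrow> 'a::finite \<Rightarrow> 's pmf"
  shows "(\<integral>\<omega>. r (fst (\<omega> t)) (snd (\<omega> t)) \<partial>trajectory P \<pi> s) = expected_reward P r \<pi> t s"
  unfolding expected_reward_def distr_trajectory_component[symmetric]
  by (subst integral_distr[OF measurable_trajectory_component]) auto

lemma expectation_state_action_pmf:
  fixes f :: "'s::finite \<times> 'a::finite \<Rightarrow> real"
  assumes "\<pi> \<in> policies"
  shows "measure_pmf.expectation (state_action_pmf \<pi> s) f = (\<Sum>a\<in>UNIV. \<pi> $ s $ a * f (s, a))"
  unfolding state_action_pmf_def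
  by (subst pmf_expectation_bind[of UNIV]) (auto simp: pmf_act_pmf[OF assms])

lemma expected_reward_0:
  assumes "\<pi> \<in> policies"
  shows "expected_reward P r \<pi> 0 s = (\<Sum>a\<in>UNIV. \<pi> $ s $ a * r s a)"
  by (simp add: expected_reward_def expectation_state_action_pmf[OF assms])

text \<open>After the first pair the process restarts from the successor state, by
  \<open>marginal_pmf_Suc_shift\<close>.\<close>

lemma expected_reward_Suc:
  fixes P :: "'s::finite \<Rightarrow> 'a::finite \<Rightarrow> 's pmf"
  assumes "\<pi> \<in> policies"
  shows "expected_reward P r \<pi> (Suc t) s =
    (\<Sum>a\<in>UNIV. \<pi> $ s $ a * (\<Sum>s'\<in>UNIV. pmf (P s a) s' * expected_reward P r \<pi> t s'))"
proof -
  have "expected_reward P r \<pi> (Suc t) s = measure_pmf.expectation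
      (state_action_pmf \<pi> s \<bind> (\<lambda>x. P (fst x) (snd x) \<bind> (\<lambda>s'. marginal_pmf P \<pi> s' t)))
      (\<lambda>x. r (fst x) (snd x))"
    unfolding expected_reward_def marginal_pmf_Suc_shift ..
  also have "\<dots> = (\<Sum>x\<in>UNIV. pmf (state_action_pmf \<pi> s) x *
      (\<Sum>s'\<in>UNIV. pmf (P (fst x) (snd x)) s' * expected_reward P r \<pi> t s'))"
    by (simp add: pmf_expectation_bind[of UNIV] expected_reward_def)
  also have "\<dots> = measure_pmf.expectation (state_action_pmf \<pi> s)
      (\<lambda>x. \<Sum>s'\<in>UNIV. pmf (P (fst x) (snd x)) s' * expected_reward P r \<pi> t s')"
    by (subst integral_measure_pmf_real[of UNIV]) (auto simp: mult.commute)
  finally show ?thesis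
    by (simp add: expectation_state_action_pmf[OF assms])
qed

text \<open>Expectation and series are exchanged by domination: rewards lie in [0,1], so the
  integral of the absolute value of term \<open>t\<close> is at most
  \<open>\<gamma> ^ t\<close>.\<close>

lemma value_fn_sums:
  fixes P :: "'s::finite \<Rightarrow> 'a::finite \<Rightarrow> 's pmf"
  assumes r: "\<And>s a. r s a \<in> {0..1}" and \<gamma>: "0 < \<gamma>" "\<gamma> < 1"
  shows "(\<lambda>t. \<gamma> ^ t * expected_reward P r \<pi> t s) sums (value_fn P r \<gamma> \<pi> $ s)"
proof -
  interpret prob_space "trajectory P \<pi> s" by (rule prob_space_trajectory)
  let ?f = "\<lambda>t \<omega>. \<gamma> ^ t * r (fst (\<omega> t)) (snd (\<omega> t))"
  have r': "0 \<le> r s a" "r s a \<le> 1" for s a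
    using r[of s a] by auto
  have bnd: "norm (?f t \<omega>) \<le> \<gamma> ^ t" for t \<omega>
    using \<gamma> r' by (simp add: abs_mult mult_left_le)
  have meas: "?f t \<in> borel_measurable (trajectory P \<pi> s)" for t
    using measurable_compose[OF measurable_trajectory_component[of t P \<pi> s],
        of "\<lambda>x. \<gamma> ^ t * r (fst x) (snd x)" borel] by simp
  have int: "integrable (trajectory P \<pi> s) (?f t)" for t
    using bnd meas by (intro integrable_const_bound[where B="\<gamma> ^ t"]) auto
  have summ: "summable (\<lambda>t. \<gamma> ^ t)" using \<gamma> by simp
  have "(\<lambda>t. \<integral>\<omega>. ?f t \<omega> \<partial>trajectory P \<pi> s) sums (\<integral>\<omega>. (\<Sum>t. ?f t \<omega>) \<partial>trajectory P \<pi> s)"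
  proof (rule sums_integral)
    show "AE \<omega> in trajectory P \<pi> s. summable (\<lambda>t. norm (?f t \<omega>))"
      using bnd by (intro AE_I2 summable_comparison_test'[OF summ, of 0]) auto
    have "(\<integral>\<omega>. norm (?f t \<omega>) \<partial>trajectory P \<pi> s) \<le> \<gamma> ^ t" for t
      using integral_mono[OF integrable_norm[OF int[of t]], of "\<lambda>_. \<gamma> ^ t"] bnd[of t] by (simp add: prob_space)
    then show "summable (\<lambda>t. \<integral>\<omega>. norm (?f t \<omega>) \<partial>trajectory P \<pi> s)"
      by (intro summable_comparison_test'[OF summ, of 0]) auto
  qed (rule int)
  then show ?thesis
    by (simp add: value_fn_def trajectory_reward)
qed

text \<open>Isolated because both Bellman operators factor through it: averaging over actions under
  \<open>\<pi>\<close> gives the policy operator \<open>T^\<pi>\<close>, maximising over them gives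
  \<open>bellman_op\<close>.\<close>

definition q_op ::
  "('s::finite \<Rightarrow> 'a::finite \<Rightarrow> 's pmf) \<Rightarrow> ('s \<Rightarrow> 'a \<Rightarrow> real) \<Rightarrow> real \<Rightarrow> real ^ 's \<Rightarrow> real ^ 'a ^ 's" where
  "q_op P r \<gamma> V = (\<chi> s a. r s a + \<gamma> * trans_op P V $ s $ a)"

text \<open>Split off time 0; the rest of the series is \<open>\<gamma>\<close> times the average of
  the series of the successor states.\<close>

lemma value_fn_bellman:
  fixes P :: "'s::finite \<Rightarrow> 'a::finite \<Rightarrow> 's pmf"
  assumes "\<And>s a. r s a \<in> {0..1}" "0 < \<gamma>" "\<gamma> < 1" and \<pi>: "\<pi> \<in> policies"
  shows "policy_op \<pi> (q_op P r \<gamma> (value_fn P r \<gamma> \<pi>)) = value_fn P r \<gamma> \<pi>"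
proof (rule vec_eq_iff[THEN iffD2], rule allI)
  fix s
  let ?V = "value_fn P r \<gamma> \<pi>" and ?e = "expected_reward P r \<pi>"
  have sums: "(\<lambda>t. \<gamma> ^ t * ?e t s) sums (?V $ s)" for s
    by (rule value_fn_sums) fact+
  have "(\<lambda>t. \<gamma> ^ Suc t * ?e (Suc t) s) =
      (\<lambda>t. \<gamma> * (\<Sum>a\<in>UNIV. \<pi> $ s $ a * (\<Sum>s'\<in>UNIV. pmf (P s a) s' * (\<gamma> ^ t * ?e t s'))))"
    by (simp add: expected_reward_Suc[OF \<pi>] sum_distrib_left mult_ac)
  moreover have "\<dots> sums
      (\<gamma> * (\<Sum>a\<in>UNIV. \<pi> $ s $ a * (\<Sum>s'\<in>UNIV. pmf (P s a) s' * ?V $ s')))"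
    by (intro sums_mult sums_sum sums)
  ultimately have "(\<lambda>t. \<gamma> ^ Suc t * ?e (Suc t) s) sums \<dots>" by simp
  from sums_Suc[OF this] sums[of s]
  have "?V $ s = \<gamma> * (\<Sum>a\<in>UNIV. \<pi> $ s $ a * (\<Sum>s'\<in>UNIV. pmf (P s a) s' * ?V $ s')) + ?e 0 s"
    by (simp add: sums_iff)
  then show "policy_op \<pi> (q_op P r \<gamma> ?V) $ s = ?V $ s"
    by (simp add: policy_op_def q_op_def trans_op_def expected_reward_0[OF \<pi>] sum.distrib
        sum_distrib_left algebra_simps)
qed

section \<open>Bellman operators\<close>

text \<open>The contraction argument in one-sided form: inserting the largest component for
  \<open>m\<close> gives \<open>m \<le> \<gamma> * m + e\<close>.\<close>

lemma contraction_upper_bound: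
  fixes x :: "real ^ 's::finite"
  assumes \<gamma>: "\<gamma> < 1" and step: "\<And>m. (\<And>s. x $ s \<le> m) \<Longrightarrow> \<forall>s. x $ s \<le> \<gamma> * m + e"
  shows "x $ s \<le> e / (1 - \<gamma>)"
proof -
  define m where "m = (MAX s. x $ s)"
  have m: "x $ s \<le> m" for s
    unfolding m_def by (rule Max_ge) auto
  \<comment> \<open>The maximum is attained, so a bound on all components applies to
    \<open>m\<close> itself.\<close>
  have "m \<in> range (\<lambda>s. x $ s)"
    unfolding m_def by (rule Max_in) auto
  then have "m \<le> \<gamma> * m + e"
    using step[OF m] by auto
  then have "m \<le> e / (1 - \<gamma>)"
    using \<gamma> by (simp add: field_simps)
  with m show ?thesis by (meson order_trans)
qed

lemma simplex_average_mono:
  assumes "\<pi> \<in> policies" "\<And>a. f a \<le> g a + e"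
  shows "(\<Sum>a\<in>UNIV. \<pi> $ s $ a * f a) \<le> (\<Sum>a\<in>UNIV. \<pi> $ s $ a * g a) + (e :: real)"
proof -
  have \<pi>: "\<And>a. 0 \<le> \<pi> $ s $ a" "(\<Sum>a\<in>UNIV. \<pi> $ s $ a) = 1"
    using assms(1) by (auto simp: policies_def prob_simplex_def)
  have "(\<Sum>a\<in>UNIV. \<pi> $ s $ a * f a) \<le> (\<Sum>a\<in>UNIV. \<pi> $ s $ a * (g a + e))"
    using assms(2) \<pi>(1) by (intro sum_mono mult_left_mono)
  also have "\<dots> = (\<Sum>a\<in>UNIV. \<pi> $ s $ a * g a) + e"
    by (simp add: distrib_left sum.distrib \<pi>(2) flip: sum_distrib_right)
  finally show ?thesis .
qed

lemma policy_op_mono: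
  assumes "\<pi> \<in> policies" "\<And>a. Q $ s $ a \<le> Q' $ s $ a + e"
  shows "policy_op \<pi> Q $ s \<le> policy_op \<pi> Q' $ s + e"
  using simplex_average_mono[OF assms] by (simp add: policy_op_def)

lemma policy_op_le:
  assumes "\<pi> \<in> policies" "\<And>a. Q $ s $ a \<le> e"
  shows "policy_op \<pi> Q $ s \<le> e"
  using simplex_average_mono[OF assms(1), of "\<lambda>a. Q $ s $ a" "\<lambda>_. 0" e s] assms(2)
  by (simp add: policy_op_def)

text \<open>The slack \<open>e\<close> combines monotonicity (\<open>e = 0\<close>) with
  contraction: transition probabilities sum to 1, so a constant shift is merely discounted.\<close>

lemma q_op_mono:
  fixes P :: "'s::finite \<Rightarrow> 'a::finite \<Rightarrow> 's pmf"
  assumes "0 \<le> \<gamma>" "\<And>s. V $ s \<le> W $ s + e"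
  shows "q_op P r \<gamma> V $ s $ a \<le> q_op P r \<gamma> W $ s $ a + \<gamma> * e"
proof -
  have "(\<Sum>s'\<in>UNIV. pmf (P s a) s' * V $ s') \<le> (\<Sum>s'\<in>UNIV. pmf (P s a) s' * (W $ s' + e))"
    using assms(2) by (intro sum_mono mult_left_mono) auto
  also have "\<dots> = (\<Sum>s'\<in>UNIV. pmf (P s a) s' * W $ s') + e"
    by (simp add: distrib_left sum.distrib sum_pmf_eq_1 flip: sum_distrib_right)
  finally have "\<gamma> * (\<Sum>s'\<in>UNIV. pmf (P s a) s' * V $ s') \<le>
      \<gamma> * ((\<Sum>s'\<in>UNIV. pmf (P s a) s' * W $ s') + e)"
    using assms(1) by (rule mult_left_mono)
  then show ?thesis
    by (simp add: q_op_def trans_op_def distrib_left)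
qed

lemma bellman_op_q_op: "bellman_op P r \<gamma> V $ s = (MAX a. q_op P r \<gamma> V $ s $ a)"
  by (simp add: bellman_op_def q_op_def)

lemma q_op_le_bellman_op: "q_op P r \<gamma> V $ s $ a \<le> bellman_op P r \<gamma> V $ s"
  unfolding bellman_op_q_op by (rule Max_ge) auto

lemma bellman_op_le_iff: "bellman_op P r \<gamma> V $ s \<le> x \<longleftrightarrow> (\<forall>a. q_op P r \<gamma> V $ s $ a \<le> x)"
  unfolding bellman_op_q_op by (subst Max_le_iff) auto

lemma bellman_op_mono:
  fixes P :: "'s::finite \<Rightarrow> 'a::finite \<Rightarrow> 's pmf"
  assumes "0 \<le> \<gamma>" "\<And>s. V $ s \<le> W $ s + e"
  shows "bellman_op P r \<gamma> V $ s \<le> bellman_op P r \<gamma> W $ s + \<gamma> * e"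
  unfolding bellman_op_le_iff
  using q_op_mono[where P = P and r = r, OF assms] q_op_le_bellman_op[of P r \<gamma> W s]
  by (meson add_right_mono order_trans)

lemma bellman_op_funpow_mono:
  fixes P :: "'s::finite \<Rightarrow> 'a::finite \<Rightarrow> 's pmf"
  assumes "0 \<le> \<gamma>" "\<And>s. V $ s \<le> W $ s + e"
  shows "(bellman_op P r \<gamma> ^^ n) V $ s \<le> (bellman_op P r \<gamma> ^^ n) W $ s + \<gamma> ^ n * e"
proof (induction n arbitrary: s)
  case (Suc n)
  from bellman_op_mono[OF assms(1) Suc, of P r s] show ?case
    by (simp add: mult_ac)
qed (simp add: assms(2))

text \<open>Monotonicity carries \<open>V \<le> T V\<close> through every further application of the
  operator, so the iterates increase.\<close>

lemma le_bellman_op_funpow: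
  fixes P :: "'s::finite \<Rightarrow> 'a::finite \<Rightarrow> 's pmf"
  assumes "0 \<le> \<gamma>" "\<And>s. V $ s \<le> bellman_op P r \<gamma> V $ s"
  shows "(bellman_op P r \<gamma> ^^ n) V $ s \<le> (bellman_op P r \<gamma> ^^ Suc n) V $ s"
    and "V $ s \<le> (bellman_op P r \<gamma> ^^ n) V $ s"
proof -
  show *: "(bellman_op P r \<gamma> ^^ n) V $ s \<le> (bellman_op P r \<gamma> ^^ Suc n) V $ s" for n s
    using bellman_op_funpow_mono[of \<gamma> V "bellman_op P r \<gamma> V" 0 n P r s] assms
    by (simp add: funpow_swap1)
  show "V $ s \<le> (bellman_op P r \<gamma> ^^ n) V $ s"
    by (induction n) (auto intro: order_trans *[simplified])
qed

lemma policy_op_q_op_mono: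
  fixes P :: "'s::finite \<Rightarrow> 'a::finite \<Rightarrow> 's pmf"
  assumes "\<pi> \<in> policies" "0 \<le> \<gamma>" "\<And>s. V $ s \<le> W $ s + e"
  shows "policy_op \<pi> (q_op P r \<gamma> V) $ s \<le> policy_op \<pi> (q_op P r \<gamma> W) $ s + \<gamma> * e"
  by (intro policy_op_mono assms(1) q_op_mono assms)

lemma axis_in_prob_simplex: "axis a 1 \<in> prob_simplex"
  by (simp add: prob_simplex_def axis_def)

lemma policies_nonempty: "policies \<noteq> ({} :: (real ^ 'a::finite ^ 's::finite) set)"
proof -
  have "(\<chi> s. axis undefined 1) \<in> (policies :: (real ^ 'a ^ 's) set)"
    by (simp add: policies_def axis_in_prob_simplex)
  then show ?thesis by blast
qed

section \<open>Value bounds for a fixed decision process\<close>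

context
  fixes P :: "'s::finite \<Rightarrow> 'a::finite \<Rightarrow> 's pmf"
    and r :: "'s \<Rightarrow> 'a \<Rightarrow> real" and \<gamma> :: real
  assumes r: "\<And>s a. r s a \<in> {0..1}" and \<gamma>: "0 < \<gamma>" "\<gamma> < 1"
begin

lemma value_fn_le_bellman_op:
  assumes "\<pi> \<in> policies"
  shows "value_fn P r \<gamma> \<pi> $ s \<le> bellman_op P r \<gamma> (value_fn P r \<gamma> \<pi>) $ s"
proof -
  have "policy_op \<pi> (q_op P r \<gamma> (value_fn P r \<gamma> \<pi>)) $ s \<le> bellman_op P r \<gamma> (value_fn P r \<gamma> \<pi>) $ s"
    by (rule policy_op_le[OF assms q_op_le_bellman_op])
  then show ?thesis
    by (simp add: value_fn_bellman[OF r \<gamma> assms])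
qed

text \<open>Provides the uniform bound that makes the supremum in \<open>opt_value\<close> a genuine
  one.\<close>

lemma value_fn_le:
  assumes "\<pi> \<in> policies"
  shows "value_fn P r \<gamma> \<pi> $ s \<le> 1 / (1 - \<gamma>)"
proof (rule contraction_upper_bound[OF \<gamma>(2)], rule allI)
  fix m s
  let ?V = "value_fn P r \<gamma> \<pi>"
  assume m: "\<And>s. ?V $ s \<le> m"
  have "r s a \<le> 1" for s a using r[of s a] by simp
  \<comment> \<open>At the zero function the action values are the rewards; a shift by
    \<open>m\<close> then adds \<open>\<gamma> * m\<close>.\<close>
  then have "q_op P r \<gamma> 0 $ s $ a \<le> 1" for s a
    by (simp add: q_op_def trans_op_def)
  then have "q_op P r \<gamma> ?V $ s $ a \<le> \<gamma> * m + 1" for a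
    using q_op_mono[of \<gamma> ?V 0 m P r s a] \<gamma> m by (smt (verit) zero_index)
  then have "policy_op \<pi> (q_op P r \<gamma> ?V) $ s \<le> \<gamma> * m + 1"
    by (rule policy_op_le[OF assms])
  then show "?V $ s \<le> \<gamma> * m + 1"
    by (simp add: value_fn_bellman[OF r \<gamma> assms])
qed

lemma value_fn_le_opt_value:
  assumes "\<pi> \<in> policies"
  shows "value_fn P r \<gamma> \<pi> $ s \<le> opt_value P r \<gamma> $ s"
  using value_fn_le assms
  by (auto simp: opt_value_def intro!: cSUP_upper bdd_aboveI[of _ "1 / (1 - \<gamma>)"])

text \<open>Each policy value lies below its own Bellman image, hence by monotonicity below that of
  the optimum; then take the supremum over policies.\<close>

lemma opt_value_le_bellman_op: "opt_value P r \<gamma> $ s \<le> bellman_op P r \<gamma> (opt_value P r \<gamma>) $ s"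
proof -
  have "value_fn P r \<gamma> \<pi> $ s \<le> bellman_op P r \<gamma> (opt_value P r \<gamma>) $ s" if \<pi>: "\<pi> \<in> policies" for \<pi>
  proof -
    have "bellman_op P r \<gamma> (value_fn P r \<gamma> \<pi>) $ s \<le> bellman_op P r \<gamma> (opt_value P r \<gamma>) $ s + \<gamma> * 0"
      using value_fn_le_opt_value[OF \<pi>] \<gamma> by (intro bellman_op_mono) auto
    with value_fn_le_bellman_op[OF \<pi>, of s] show ?thesis by simp
  qed
  then show ?thesis
    by (subst opt_value_def) (simp add: cSUP_least policies_nonempty)
qed

text \<open>With \<open>V*\<close> the optimum, chain \<open>V* \<le> T^h V*\<close> and
  \<open>T^h V* \<le> T^h V + \<gamma> ^ h * e\<close>.\<close>

lemma opt_value_diff_lookahead: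
  assumes "\<And>s. opt_value P r \<gamma> $ s \<le> V $ s + e"
  shows "opt_value P r \<gamma> $ s \<le> (bellman_op P r \<gamma> ^^ h) V $ s + \<gamma> ^ h * e"
  using le_bellman_op_funpow(2)[of \<gamma> "opt_value P r \<gamma>" P r s h, OF _ opt_value_le_bellman_op]
    bellman_op_funpow_mono[where \<gamma> = \<gamma> and P = P and r = r and n = h and s = s, OF _ assms] \<gamma> by simp

text \<open>The policy value is a fixed point of \<open>T^\<pi>\<close>, so contraction bounds its
  deficit below \<open>W\<close> by \<open>e / (1 - \<gamma>)\<close>; one more application of
  \<open>T^\<pi>\<close> discounts this. The extra factor \<open>\<gamma>\<close> later keeps the
  total loss at \<open>e / (1 - \<gamma>)\<close>.\<close>

lemma value_fn_ge:
  assumes \<pi>: "\<pi> \<in> policies" and e: "\<And>s. W $ s \<le> policy_op \<pi> (q_op P r \<gamma> W) $ s + e"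
  shows "policy_op \<pi> (q_op P r \<gamma> W) $ s \<le> value_fn P r \<gamma> \<pi> $ s + \<gamma> * (e / (1 - \<gamma>))"
proof -
  let ?V = "value_fn P r \<gamma> \<pi>"
  have "(W - ?V) $ s \<le> e / (1 - \<gamma>)" for s
  proof (rule contraction_upper_bound[OF \<gamma>(2)], rule allI)
    fix m s
    assume "\<And>s. (W - ?V) $ s \<le> m"
    then have "policy_op \<pi> (q_op P r \<gamma> W) $ s \<le> policy_op \<pi> (q_op P r \<gamma> ?V) $ s + \<gamma> * m"
      using \<gamma> by (intro policy_op_q_op_mono[OF \<pi>]) (auto simp: algebra_simps)
    with e[of s] show "(W - ?V) $ s \<le> \<gamma> * m + e"
      by (simp add: value_fn_bellman[OF r \<gamma> \<pi>])
  qed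
  then have "policy_op \<pi> (q_op P r \<gamma> W) $ s \<le> policy_op \<pi> (q_op P r \<gamma> ?V) $ s + \<gamma> * (e / (1 - \<gamma>))"
    using \<gamma> by (intro policy_op_q_op_mono[OF \<pi>]) (auto simp: algebra_simps)
  then show ?thesis by (simp add: value_fn_bellman[OF r \<gamma> \<pi>])
qed

lemma lookahead_Q_q_op:
  "lookahead_Q P r \<gamma> h \<pi> = q_op P r \<gamma> ((bellman_op P r \<gamma> ^^ (h - 1)) (value_fn P r \<gamma> \<pi>))"
  by (simp add: lookahead_Q_def q_op_def)

text \<open>Applied to \<open>W = \<T>\<^sup>h\<^sup>-\<^sup>1 V\<^sup>\<pi>\<close>: since \<open>W \<le> \<T> W\<close>, an \<open>e\<close>-greedy policy satisfies
  \<open>W \<le> \<T>\<^sup>\<pi>' W + e\<close>, and hence evaluating it exactly loses at most another \<open>\<gamma> e / (1 - \<gamma>)\<close>.\<close>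

lemma value_fn_near_greedy:
  assumes \<pi>: "\<pi> \<in> policies" and \<pi>': "\<pi>' \<in> policies" and h: "h \<ge> 1"
    and greedy: "\<And>s a. lookahead_Q P r \<gamma> h \<pi> $ s $ a \<le> policy_op \<pi>' (lookahead_Q P r \<gamma> h \<pi>) $ s + e"
  shows "(bellman_op P r \<gamma> ^^ h) (value_fn P r \<gamma> \<pi>) $ s \<le> value_fn P r \<gamma> \<pi>' $ s + e / (1 - \<gamma>)"
proof -
  let ?V = "value_fn P r \<gamma> \<pi>"
  define W where "W = (bellman_op P r \<gamma> ^^ (h - 1)) ?V"
  \<comment> \<open>As \<open>h \<ge> 1\<close>, one Bellman step can be split off, and the action
    values at \<open>W\<close> are exactly the lookahead values.\<close>
  have h_eq: "h = Suc (h - 1)" using h by simp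
  have TW: "(bellman_op P r \<gamma> ^^ h) ?V = bellman_op P r \<gamma> W"
    by (subst h_eq) (simp add: W_def)
  have TW_le: "bellman_op P r \<gamma> W $ s \<le> policy_op \<pi>' (q_op P r \<gamma> W) $ s + e" for s
    using greedy by (simp add: bellman_op_le_iff lookahead_Q_q_op W_def)
  have "W $ s \<le> bellman_op P r \<gamma> W $ s" for s
    using le_bellman_op_funpow(1)[OF _ value_fn_le_bellman_op[OF \<pi>], of "h - 1" s] \<gamma>
    by (simp add: W_def)
  then have "W $ s \<le> policy_op \<pi>' (q_op P r \<gamma> W) $ s + e" for s
    using TW_le order_trans by blast
  then have "bellman_op P r \<gamma> W $ s \<le> value_fn P r \<gamma> \<pi>' $ s + (\<gamma> * (e / (1 - \<gamma>)) + e)"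
    using value_fn_ge[OF \<pi>', of W e s] TW_le[of s] by simp
  also have "\<gamma> * (e / (1 - \<gamma>)) + e = e / (1 - \<gamma>)"
    using \<gamma> by (simp add: field_simps)
  finally show ?thesis by (simp add: TW)
qed

end

section \<open>Mirror descent steps\<close>

lemma infnorm_le_cart:
  fixes x :: "real ^ 'n::finite"
  assumes "\<And>i. \<bar>x $ i\<bar> \<le> e"
  shows "infnorm x \<le> e"
  unfolding infnorm_cart using assms by (intro cSup_least) auto

lemma component_le_infnorm_matrix:
  fixes x :: "real ^ 'n::finite ^ 'm::finite"
  shows "\<bar>x $ i $ j\<bar> \<le> infnorm x"
  using Basis_le_infnorm[of "axis i (axis j 1)" x] by (simp add: inner_axis axis_in_Basis_iff)

text \<open>Compare with the policy that plays \<open>a\<close> in every state.\<close>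

lemma Q_le_greedy:
  fixes Q :: "real ^ 'a::finite ^ 's::finite"
  assumes "\<pi> \<in> greedy_policies Q"
  shows "Q $ s $ a \<le> policy_op \<pi> Q $ s"
proof -
  have "(\<chi> s. axis a 1) \<in> (policies :: (real ^ 'a ^ 's) set)"
    by (simp add: policies_def axis_in_prob_simplex)
  moreover have "policy_op (\<chi> s. axis a 1) Q $ s = Q $ s $ a"
    by (simp add: policy_op_def axis_def if_distrib[of "\<lambda>x. x * _"] cong: if_cong)
  ultimately show ?thesis
    using assms unfolding greedy_policies_def is_arg_max_linorder by (metis (mono_tags, lifting) mem_Collect_eq)
qed

lemma greedy_policies_subset: "greedy_policies Q \<subseteq> policies"
  by (auto simp: greedy_policies_def is_arg_max_def)

text \<open>Choosing a maximising action in each state gives one policy that is greedy everywhere,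
  so the infimum in \<open>min_greedy_divergence\<close> is over a nonempty set.\<close>

lemma greedy_policies_nonempty:
  fixes Q :: "real ^ 'a::finite ^ 's::finite"
  shows "greedy_policies Q \<noteq> {}"
proof -
  define m where "m s = (MAX a. Q $ s $ a)" for s
  have m: "Q $ s $ a \<le> m s" for s a
    unfolding m_def by (rule Max_ge) auto
  have "m s \<in> range (\<lambda>a. Q $ s $ a)" for s
    unfolding m_def by (rule Max_in) auto
  then have "\<forall>s. \<exists>a. Q $ s $ a = m s"
    by (metis imageE)
  then obtain act where act: "\<And>s. Q $ s $ act s = m s"
    by metis
  have "policy_op (\<chi> s. axis (act s) 1) Q $ s = m s" for s
    by (simp add: policy_op_def axis_def act if_distrib[of "\<lambda>x. x * _"] cong: if_cong)
  then have "(\<chi> s. axis (act s) 1) \<in> greedy_policies Q"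
    using policy_op_le[where Q = Q, OF _ m]
    by (auto simp: greedy_policies_def is_arg_max_linorder policies_def axis_in_prob_simplex)
  then show ?thesis by blast
qed

text \<open>Optimality of the step against a greedy \<open>\<rho>\<close> bounds
  \<open>\<eta>\<close> times the greedy gap by the divergence of \<open>\<rho>\<close> from
  \<open>\<pi>\<close>; the stepsize condition bounds the infimum of these divergences by
  \<open>\<eta> * c\<close>.\<close>

lemma mirror_step_near_greedy:
  fixes Q :: "real ^ 'a::finite ^ 's::finite"
  assumes leg: "legendre_type \<phi> D" and sub: "prob_simplex \<subseteq> D"
    and c: "0 < c" and \<eta>: "0 < \<eta>"
    and \<pi>: "\<And>s. \<pi> $ s \<in> rel_interior D"
    and step: "is_arg_max (\<lambda>p. \<eta> * (Q $ s \<bullet> p) - bregman \<phi> D p (\<pi> $ s))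
           (\<lambda>p. p \<in> prob_simplex) (\<pi>' $ s)"
    and size: "\<eta> \<ge> 1 / c * infnorm (min_greedy_divergence \<phi> D Q \<pi>)"
  shows "Q $ s $ a \<le> policy_op \<pi>' Q $ s + c"
proof -
  have pol: "policy_op \<rho> Q $ s = Q $ s \<bullet> \<rho> $ s" for \<rho>
    by (simp add: policy_op_def inner_vec_def mult.commute)
  have \<pi>': "\<pi>' $ s \<in> prob_simplex"
    using step by (simp add: is_arg_max_def)
  have "\<eta> * (Q $ s $ a - policy_op \<pi>' Q $ s) \<le> policy_bregman \<phi> D \<rho> \<pi> $ s"
    if \<rho>: "\<rho> \<in> greedy_policies Q" for \<rho>
  proof -
    have "\<rho> $ s \<in> prob_simplex"
      using \<rho> greedy_policies_subset by (force simp: policies_def)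
    then have "\<eta> * (Q $ s \<bullet> \<rho> $ s) - bregman \<phi> D (\<rho> $ s) (\<pi> $ s) \<le>
        \<eta> * (Q $ s \<bullet> \<pi>' $ s) - bregman \<phi> D (\<pi>' $ s) (\<pi> $ s)"
      using step by (simp add: is_arg_max_linorder)
    moreover have "0 \<le> bregman \<phi> D (\<pi>' $ s) (\<pi> $ s)"
      using bregman_nonneg[OF leg _ \<pi>] \<pi>' sub by blast
    moreover have "\<eta> * (Q $ s $ a) \<le> \<eta> * (Q $ s \<bullet> \<rho> $ s)"
      using Q_le_greedy[OF \<rho>, of s a] \<eta> by (simp add: pol)
    ultimately show ?thesis
      by (simp add: policy_bregman_def pol right_diff_distrib)
  qed
  \<comment> \<open>The left side does not depend on \<open>\<rho>\<close>, so it lies below the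
    infimum.\<close>
  then have "\<eta> * (Q $ s $ a - policy_op \<pi>' Q $ s) \<le> min_greedy_divergence \<phi> D Q \<pi> $ s"
    by (simp add: min_greedy_divergence_def cINF_greatest greedy_policies_nonempty)
  also have "\<dots> \<le> infnorm (min_greedy_divergence \<phi> D Q \<pi>)"
    using component_le_infnorm_cart abs_le_D1 by blast
  also have "\<dots> \<le> \<eta> * c"
    using size c by (simp add: field_simps)
  finally show ?thesis
    using \<eta> by (simp add: mult_le_cancel_left_pos)
qed

text \<open>One \<open>b\<close> pays for the value at \<open>a\<close>, the other for the average
  under \<open>\<pi>\<close>.\<close>

lemma policy_op_near_greedy_perturb:
  fixes Q Q' :: "real ^ 'a::finite ^ 's::finite"
  assumes "\<pi> \<in> policies" "infnorm (Q' - Q) \<le> b"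
    and "\<And>a. Q' $ s $ a \<le> policy_op \<pi> Q' $ s + c"
  shows "Q $ s $ a \<le> policy_op \<pi> Q $ s + (c + 2 * b)"
proof -
  have close: "\<bar>Q' $ s $ a - Q $ s $ a\<bar> \<le> b" for a
    using component_le_infnorm_matrix[of "Q' - Q" s a] assms(2) by simp
  have "policy_op \<pi> Q' $ s \<le> policy_op \<pi> Q $ s + b"
    using close by (intro policy_op_mono[OF assms(1)]) (simp add: abs_le_iff algebra_simps)
  with assms(3)[of a] close[of a] show ?thesis by linarith
qed

section \<open>Iterating the error recursion\<close>

text \<open>Unrolling weights \<open>c (t - 1)\<close> by \<open>q ^ (k - t)\<close>, written as
  \<open>q ^ k / q ^ t\<close>. The constant \<open>K * d / (1 - q)\<close> is the fixed point of
  the map sending \<open>x\<close> to \<open>q * x + K * d\<close>, so the induction preserves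
  it.\<close>

lemma affine_recursion_bound:
  fixes e c :: "nat \<Rightarrow> real"
  assumes q: "0 < q" "q < 1" and K: "0 \<le> K"
    and step: "\<And>k. e (Suc k) \<le> q * e k + K * (c k + d)" and d: "0 \<le> d"
  shows "e k \<le> q ^ k * (e 0 + K * (\<Sum>t = 1..k. c (t - 1) / q ^ t)) + K * d / (1 - q)"
proof (induction k)
  case 0
  show ?case using K d q by simp
next
  case (Suc k)
  let ?S = "\<Sum>t = 1..k. c (t - 1) / q ^ t"
  let ?p = "q ^ Suc k" and ?A = "e 0 + K * ?S"
  have p: "?p \<noteq> 0" using q by simp
  have "e (Suc k) \<le> q * (q ^ k * ?A + K * d / (1 - q)) + K * (c k + d)"
    using q by (intro order_trans[OF step add_right_mono] mult_left_mono Suc) simp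
  also have "\<dots> = (?p * ?A + K * c k) + (q * (K * d / (1 - q)) + K * d)"
    by (simp add: distrib_left mult.assoc)
  \<comment> \<open>The new \<open>c k\<close> becomes the summand for \<open>t = Suc k\<close>,
    whose denominator cancels the prefactor \<open>?p\<close>.\<close>
  also have "?p * ?A + K * c k = ?p * (e 0 + K * (?S + c k / ?p))"
    using p by (simp add: distrib_left del: power_Suc)
  also have "q * (K * d / (1 - q)) + K * d = K * d / (1 - q)"
    using q by (simp add: divide_simps) (simp add: algebra_simps)
  finally show ?case by simp
qed

theorem theorem5p3:
  fixes P :: "'s::finite \<Rightarrow> 'a::finite \<Rightarrow> 's pmf"
    and r :: "'s \<Rightarrow> 'a \<Rightarrow> real"
    and \<gamma> b :: real
    and \<phi> :: "real ^ 'a \<Rightarrow> real"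
    and D :: "(real ^ 'a) set"
    and h :: nat
    and c \<eta> :: "nat \<Rightarrow> real"
    and \<pi> Qhat :: "nat \<Rightarrow> real ^ 'a ^ 's"
  assumes "\<And>s a. r s a \<in> {0..1}"
    and "0 < \<gamma>" "\<gamma> < 1"
    and "legendre_type \<phi> D" "prob_simplex \<subseteq> D"
    and "h \<ge> 1" "b \<ge> 0"
    and "\<And>k. c k > 0" "\<And>k. \<eta> k > 0"
    and "\<And>k. \<pi> k \<in> policies" "\<pi> 0 \<in> rel_interior policies"
    and "\<And>k s. \<pi> k $ s \<in> rel_interior D"
    and "\<And>k s. is_arg_max
           (\<lambda>p. \<eta> k * (Qhat k $ s \<bullet> p) - bregman \<phi> D p (\<pi> k $ s))
           (\<lambda>p. p \<in> prob_simplex) (\<pi> (Suc k) $ s)"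
    and "\<And>k. infnorm (Qhat k - lookahead_Q P r \<gamma> h (\<pi> k)) \<le> b"
    and "\<And>k. \<eta> k \<ge> 1 / c k * infnorm (min_greedy_divergence \<phi> D (Qhat k) (\<pi> k))"
  shows "\<forall>k. infnorm (opt_value P r \<gamma> - value_fn P r \<gamma> (\<pi> k))
           \<le> \<gamma> ^ (h * k) * (infnorm (opt_value P r \<gamma> - value_fn P r \<gamma> (\<pi> 0))
                + 1 / (1 - \<gamma>) * (\<Sum>t = 1..k. c (t - 1) / \<gamma> ^ (h * t)))
             + 2 * b / ((1 - \<gamma>) * (1 - \<gamma> ^ h))"
proof
  fix k
  note r = assms(1) and \<gamma> = assms(2,3) and leg = assms(4,5) and h = assms(6)
    and b = assms(7) and pos = assms(8,9) and pol = assms(10) and rel_int = assms(12)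
    and step = assms(13) and noise = assms(14) and size = assms(15)
  let ?V = "\<lambda>k. value_fn P r \<gamma> (\<pi> k)" and ?opt = "opt_value P r \<gamma>"
  define e where "e k = infnorm (?opt - ?V k)" for k
  have "e (Suc k) \<le> \<gamma> ^ h * e k + 1 / (1 - \<gamma>) * (c k + 2 * b)" for k
    unfolding e_def[of "Suc k"]
  proof (rule infnorm_le_cart)
    fix s
    have "?opt $ s \<le> ?V k $ s + e k" for s
      using component_le_infnorm_cart[of "?opt - ?V k" s] by (simp add: e_def)
    then have "?opt $ s \<le> (bellman_op P r \<gamma> ^^ h) (?V k) $ s + \<gamma> ^ h * e k"
      by (rule opt_value_diff_lookahead[OF r \<gamma>])
    also have "(bellman_op P r \<gamma> ^^ h) (?V k) $ s \<le> ?V (Suc k) $ s + (c k + 2 * b) / (1 - \<gamma>)"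
      by (intro value_fn_near_greedy[OF r \<gamma> pol pol h]
          policy_op_near_greedy_perturb[OF pol noise]
          mirror_step_near_greedy[OF leg pos rel_int step size])
    \<comment> \<open>Policy values stay below the optimum, so an upper bound on the difference
      bounds its absolute value.\<close>
    finally show "\<bar>(?opt - ?V (Suc k)) $ s\<bar> \<le> \<gamma> ^ h * e k + 1 / (1 - \<gamma>) * (c k + 2 * b)"
      using value_fn_le_opt_value[OF r \<gamma> pol[of "Suc k"], where P = P and s = s] by simp
  qed
  moreover have "0 < \<gamma> ^ h" "\<gamma> ^ h < 1"
    using \<gamma> h by (auto simp: power_less_one_iff)
  \<comment> \<open>The recursion is solved with \<open>q = \<gamma> ^ h\<close>,
    \<open>K = 1 / (1 - \<gamma>)\<close> and \<open>d = 2 * b\<close>.\<close>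
  ultimately have "e k \<le> (\<gamma> ^ h) ^ k *
      (e 0 + 1 / (1 - \<gamma>) * (\<Sum>t = 1..k. c (t - 1) / (\<gamma> ^ h) ^ t)) +
      1 / (1 - \<gamma>) * (2 * b) / (1 - \<gamma> ^ h)"
    using \<gamma> b by (intro affine_recursion_bound) auto
  then show "infnorm (?opt - ?V k)
      \<le> \<gamma> ^ (h * k) * (infnorm (?opt - ?V 0)
           + 1 / (1 - \<gamma>) * (\<Sum>t = 1..k. c (t - 1) / \<gamma> ^ (h * t)))
        + 2 * b / ((1 - \<gamma>) * (1 - \<gamma> ^ h))"
    by (simp add: e_def power_mult)
qed

end
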